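(* Let $G$ be a graph with $V(G)=[n]$. If $$\mathrm X_G=\sum_\lambda N_\lambda\,\tilde\Xi_\lambda$$ is the $\tilde\Xi$-expansion of $\mathrm X_G$, then $N_\lambda$ is the number of permutations of $[n]$ with $G$-ascent type $\lambda$.
   Context: $[n]=\{1,\dots,n\}$; a graph is a finite simple undirected graph. Fix a graph $G$ with vertex set $[n]$. Given a permutation $\pi$ of $[n]$ and $v\in[n]$, the rank $\rho_\pi(v)$ is the largest integer $r$ for which there exists an increasing sequence of positive integers $i_1<i_2<\cdots<i_r<i_{r+1}=\pi^{-1}(v)$ such that $\{\pi(i_j),\pi(i_{j+1})\}$ is an edge of $G$ for all $j$. The permutation $\pi$ has a $G$-ascent at $v$ (where $\pi^{-1}(v)<n$) if either (i) $\rho_\pi(v)<\rho_\pi(w)$, or (ii) $\rho_\pi(v)=\rho_\pi(w)$ and $v<w$, where $w=\pi(\pi^{-1}(v)+1)$. The $G$-ascent type of $\pi$ is the integer partition of $n$ whose parts are the lengths of the subwords obtained by breaking the one-line representation of $\pi$ after each number at which $\pi$ has a $G$-ascent. For an integer partition $\lambda$ with $r_i$ parts equal to $i$, $\tilde m_\lambda=(r_1!r_2!\cdots)m_\lambda$; a set partition in a subscript stands for the integer partition of its block sizes. The chromatic symmetric function is $\mathrm X_G=\sum_\pi\tilde m_\pi$, the sum over all stable partitions $\pi$ of $G$ (partitions of $V(G)$ with no two vertices in the same block adjacent). $D_\lambda$ is the digraph which is a disjoint union of directed paths, the $i$th having $\lambda_i$ vertices. Every subset $F$ of the edges of $D_\lambda$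 gives a spanning subgraph that is a disjoint union of directed paths (isolated vertices being paths with no edges); let $\pi(F)$ be the partition of the vertex set into the vertex sets of these paths and $\ell(\pi(F))$ their number. Then $$\tilde\Xi_\lambda=\sum_{F\subset E(D_\lambda)}\frac{\tilde m_{\pi(F)}}{\ell(\pi(F))!}.$$ The $\tilde\Xi_\lambda$ form a $\mathbb Q$-linear basis of the ring of symmetric functions. *)

theory Defs
  imports
    Complex_Main
    "HOL-Library.Multiset"
    "HOL-Library.Poly_Mapping"
    "HOL-Library.Disjoint_Sets"
    "HOL-Combinatorics.Permutations"
begin

definition simple_graph :: "nat set \<Rightarrow> nat set set \<Rightarrow> bool" where
  "simple_graph V E \<longleftrightarrow> finite V \<and> (\<forall>e\<in>E. e \<subseteq> V \<and> card e = 2)"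

(* Words are 1-indexed: \<pi> i is the i-th letter of the one-line representation of \<pi>.
   The sequence i is only constrained on {1..r + 1}. *)
definition rank :: "nat set set \<Rightarrow> (nat \<Rightarrow> nat) \<Rightarrow> nat \<Rightarrow> nat" where
  "rank E \<pi> v = (GREATEST r. \<exists>i :: nat \<Rightarrow> nat.
     (\<forall>j\<in>{1..r + 1}. 0 < i j) \<and> strict_mono_on {1..r + 1} i \<and> i (r + 1) = inv \<pi> v \<and>
     (\<forall>j\<in>{1..r}. {\<pi> (i j), \<pi> (i (j + 1))} \<in> E))"

definition G_ascent :: "nat \<Rightarrow> nat set set \<Rightarrow> (nat \<Rightarrow> nat) \<Rightarrow> nat \<Rightarrow> bool" where
  "G_ascent n E \<pi> v \<longleftrightarrow> v \<in> {1..n} \<and> inv \<pi> v < n \<and>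
     (let w = \<pi> (inv \<pi> v + 1)
      in rank E \<pi> v < rank E \<pi> w \<or> rank E \<pi> v = rank E \<pi> w \<and> v < w)"

text \<open>The nonempty subwords obtained by breaking a word after each letter satisfying \<open>P\<close>.\<close>
fun break_after :: "('a \<Rightarrow> bool) \<Rightarrow> 'a list \<Rightarrow> 'a list list" where
  "break_after P [] = []"
| "break_after P (x # xs) =
     (if P x then [x] # break_after P xs
      else (case break_after P xs of
              [] \<Rightarrow> [[x]]
            | w # ws \<Rightarrow> (x # w) # ws))"

definition G_ascent_type :: "nat \<Rightarrow> nat set set \<Rightarrow> (nat \<Rightarrow> nat) \<Rightarrow> nat multiset" where
  "G_ascent_type n E \<pi> = mset (map length (break_after (G_ascent n E \<pi>) (map \<pi> [1..<n + 1])))"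

text \<open>Integer partitions are finite multisets of positive integers.\<close>
definition integer_partition :: "nat multiset \<Rightarrow> bool" where
  "integer_partition \<mu> \<longleftrightarrow> 0 \<notin># \<mu>"

text \<open>
  A formal power series over the rationals in countably many variables is represented by its
  coefficient function: a monomial is a finitely supported exponent vector of type
  \<open>nat \<Rightarrow>\<^sub>0 nat\<close>, so linear combinations are pointwise.
\<close>
type_synonym power_series = "(nat \<Rightarrow>\<^sub>0 nat) \<Rightarrow> rat"

definition exponents :: "(nat \<Rightarrow>\<^sub>0 nat) \<Rightarrow> nat multiset" where
  "exponents a = image_mset (Poly_Mapping.lookup a) (mset_set (Poly_Mapping.keys a))"

text \<open>The monomial symmetric function: the sum of all monomials with exponents \<open>\<mu>\<close>.\<close>
definition monomial_sf :: "nat multiset \<Rightarrow> power_series" where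
  "monomial_sf \<mu> = (\<lambda>a. if exponents a = \<mu> then 1 else 0)"

definition aug_monomial_sf :: "nat multiset \<Rightarrow> power_series" where
  "aug_monomial_sf \<mu> = (\<lambda>a. (\<Prod>i\<in>set_mset \<mu>. fact (count \<mu> i)) * monomial_sf \<mu> a)"

definition block_sizes :: "'a set set \<Rightarrow> nat multiset" where
  "block_sizes P = image_mset card (mset_set P)"

definition stable_partitions :: "nat set \<Rightarrow> nat set set \<Rightarrow> nat set set set" where
  "stable_partitions V E =
     {P. partition_on V P \<and> (\<forall>B\<in>P. \<forall>u\<in>B. \<forall>v\<in>B. {u, v} \<notin> E)}"

definition chromatic_sf :: "nat set \<Rightarrow> nat set set \<Rightarrow> power_series" where
  "chromatic_sf V E = (\<lambda>a. \<Sum>P\<in>stable_partitions V E. aug_monomial_sf (block_sizes P) a)"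

text \<open>
  In the disjoint union of directed paths with \<open>\<mu>\<^sub>i\<close> vertices, the vertex \<open>(i, j)\<close> is the
  \<open>j\<close>-th vertex of the \<open>i\<close>-th path (both counted from 0), parts being listed in
  weakly decreasing order.
\<close>
definition parts_list :: "nat multiset \<Rightarrow> nat list" where
  "parts_list \<mu> = rev (sorted_list_of_multiset \<mu>)"

definition path_verts :: "nat multiset \<Rightarrow> (nat \<times> nat) set" where
  "path_verts \<mu> = {(i, j). i < length (parts_list \<mu>) \<and> j < parts_list \<mu> ! i}"

definition path_edges :: "nat multiset \<Rightarrow> ((nat \<times> nat) \<times> (nat \<times> nat)) set" where
  "path_edges \<mu> =
     {((i, j), (i, j + 1)) | i j. i < length (parts_list \<mu>) \<and> j + 1 < parts_list \<mu> ! i}"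

text \<open>The vertex sets of the weakly connected components of the digraph \<open>(V, F)\<close>.\<close>
definition components :: "'a set \<Rightarrow> ('a \<times> 'a) set \<Rightarrow> 'a set set" where
  "components V F = V // (F \<union> F\<inverse>)\<^sup>*"

definition Xi_sf :: "nat multiset \<Rightarrow> power_series" where
  "Xi_sf \<mu> = (\<lambda>a. \<Sum>F\<in>Pow (path_edges \<mu>).
     aug_monomial_sf (block_sizes (components (path_verts \<mu>) F)) a
       / fact (card (components (path_verts \<mu>) F)))"

end

theory Submission
  imports Defs "HOL-Combinatorics.Multiset_Permutations" "HOL-Library.Product_Lexorder"
begin

text \<open>
  By uniqueness of the expansion it suffices to prove two things: the \<open>Xi_sf \<mu>\<close> are linearly
  independent, and the chromatic symmetric function is the sum of \<open>Xi_sf (G_ascent_type n E \<pi>)\<close>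
  over all permutations \<open>\<pi>\<close>.

  Independence is triangularity by number of parts. Deleting an edge of a union of paths creates
  exactly one more component, so every term of \<open>Xi_sf \<mu>\<close> other than the one keeping all edges
  belongs to a partition with more parts than \<open>\<mu>\<close> (\<open>Xi_sf_coeff\<close>). In a vanishing combination, look
  at the coefficient indexed by a partition with fewest parts (\<open>Xi_sf_independent\<close>).

  For the sum over permutations, take the letters of the word of \<open>\<pi>\<close> as the vertices of the union of
  paths, the paths being the segments between consecutive ascents. A set of kept edges is then the
  same as a way of cutting the word into nonempty segments that cuts at least at every ascent, so
  that inside a segment the pairs (rank, letter) decrease lexicographically
  (\<open>Xi_sf_G_ascent_type\<close>). The main point is that pairs of a permutation and such a cutting
  correspond to ordered stable partitions, by forgetting the order inside each segment
  (\<open>bij_betw_ordered_stable_partitions\<close>). A segment is stable because along an edge of the graph the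
  rank strictly increases from left to right, whereas inside a segment it never does. Conversely,
  when all blocks are stable, an edge always joins two different blocks, so the ranks are determined
  by the order of the blocks alone, and there is exactly one way of sorting each block by
  decreasing (rank, letter).

  A stable partition with \<open>k\<close> blocks has \<open>k!\<close> orderings, which cancels the denominators in
  the definition of \<open>Xi_sf\<close> and leaves the chromatic symmetric function
  (\<open>chromatic_sf_eq_sum_Xi_sf\<close>).
\<close>

section \<open>Cutting a word into segments\<close>

text \<open>
  The edges of the disjoint union of directed paths that traverse the words of \<open>vs\<close>.
\<close>

definition links :: "'a list list \<Rightarrow> ('a \<times> 'a) set" where
  "links vs = (\<Union>v\<in>set vs. set (zip v (tl v)))"

lemma links_simps [simp]:
  "links [] = {}" "links (v # vs) = set (zip v (tl v)) \<union> links vs"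
  by (auto simp: links_def)

lemma set_zip_tl_Cons: "set (zip (x # xs) xs) = (if xs = [] then {} else insert (x, hd xs) (set (zip xs (tl xs))))"
  by (cases xs) auto

lemma links_subset: "links vs \<subseteq> set (concat vs) \<times> set (concat vs)"
proof -
  have "set (tl v) \<subseteq> set v" for v :: "'a list" by (cases v) auto
  then show ?thesis
    by (fastforce simp: links_def dest: set_zip_leftD set_zip_rightD)
qed

lemma links_map: "links (map (map f) vs) = map_prod f f ` links vs"
  by (induction vs) (auto simp: zip_map_map map_tl[symmetric] image_Un)

lemma concat_break_after [simp]: "concat (break_after Q xs) = xs"
  by (induction xs) (auto split: list.splits)

lemma Nil_notin_break_after [simp]: "[] \<notin> set (break_after Q xs)"
  by (induction xs) (auto split: list.splits)

lemma break_after_eq_Nil_iff [simp]: "break_after Q xs = [] \<longleftrightarrow> xs = []"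
  by (cases xs) (auto split: list.splits)

lemma links_break_after: "links (break_after Q xs) = {(a, b) \<in> set (zip xs (tl xs)). \<not> Q a}"
proof (induction xs)
  case (Cons x xs)
  show ?case
  proof (cases "xs = []")
    case False
    then obtain w ws where w: "break_after Q xs = w # ws"
      by (cases "break_after Q xs") auto
    moreover have "w \<noteq> []" using Nil_notin_break_after[of Q xs] w by auto
    moreover have "hd w = hd xs"
      using concat_break_after[of Q xs] w \<open>w \<noteq> []\<close> by (metis concat.simps(2) hd_append2)
    ultimately show ?thesis
      using Cons False by (auto simp: set_zip_tl_Cons)
  qed simp
qed simp

lemma break_after_append:
  assumes "v \<noteq> []" "Q (last v)" "\<forall>x\<in>set (butlast v). \<not> Q x"
  shows "break_after Q (v @ xs) = v # break_after Q xs"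
  using assms by (induction v) (auto split: if_splits)

lemma break_after_concat:
  assumes "\<And>v. v \<in> set vs \<Longrightarrow> v \<noteq> [] \<and> Q (last v) \<and> (\<forall>x\<in>set (butlast v). \<not> Q x)"
  shows "break_after Q (concat vs) = vs"
  using assms
proof (induction vs)
  case (Cons v vs)
  have "break_after Q (v @ concat vs) = v # break_after Q (concat vs)"
    by (rule break_after_append) (use Cons.prems in auto)
  moreover have "break_after Q (concat vs) = vs"
    by (rule Cons.IH) (use Cons.prems in auto)
  ultimately show ?case by simp
qed simp

lemma Domain_zip_tl: "Domain (set (zip v (tl v))) = set (butlast v)"
proof (induction v)
  case (Cons x v) then show ?case by (cases "v = []") (auto simp: set_zip_tl_Cons)
qed simp

lemma Domain_links: "Domain (links vs) = (\<Union>v\<in>set vs. set (butlast v))"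
  by (simp add: links_def Domain_Union Domain_zip_tl)

text \<open>
  The letters with an outgoing edge are exactly those that are not last in their segment, so
  cutting after all other letters recovers the segments. Distinctness of the letters is what makes
  "having an outgoing edge" a property of the letter.
\<close>

lemma break_after_links:
  assumes "distinct (concat vs)" "[] \<notin> set vs"
  shows "break_after (\<lambda>x. x \<notin> Domain (links vs)) (concat vs) = vs"
proof (rule break_after_concat)
  fix v assume v: "v \<in> set vs"
  then have ne: "v \<noteq> []" using assms by auto
  have "last v \<notin> set (butlast u)" if "u \<in> set vs" for u
  proof
    assume l: "last v \<in> set (butlast u)"
    then have "u = v"
      using v that ne assms(1) unfolding distinct_concat_iff
      by (metis disjoint_iff in_set_butlastD last_in_set)
    moreover have "distinct (butlast v @ [last v])"
      using v assms(1) ne by (simp add: distinct_concat_iff)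
    ultimately show False using l by auto
  qed
  then show "v \<noteq> [] \<and> last v \<notin> Domain (links vs) \<and>
      (\<forall>x\<in>set (butlast v). \<not> x \<notin> Domain (links vs))"
    using v ne by (auto simp: Domain_links)
qed

definition segmentations :: "'a list \<Rightarrow> 'a list list set" where
  "segmentations xs = {vs. concat vs = xs \<and> [] \<notin> set vs}"

lemma zip_tl_functional:
  assumes "distinct xs" "(a, b) \<in> set (zip xs (tl xs))" "(a, c) \<in> set (zip xs (tl xs))"
  shows "b = c"
  using assms by (metis distinct_zipI1 eq_key_imp_eq_value distinct_map map_fst_zip_take distinct_take)

lemma links_subset_zip: "links vs \<subseteq> set (zip (concat vs) (tl (concat vs)))"
  if "[] \<notin> set vs"
  using that
proof (induction vs)
  case (Cons v vs)
  have "set (zip v (tl v)) \<subseteq> set (zip (v @ ys) (tl (v @ ys)))" for ys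
    by (induction v) (auto simp: set_zip_tl_Cons)
  moreover have "set (zip ys (tl ys)) \<subseteq> set (zip (v @ ys) (tl (v @ ys)))" for ys
    by (induction v) (auto simp: set_zip_tl_Cons)
  ultimately show ?case using Cons by fastforce
qed simp

text \<open>
  Cutting a word means choosing which consecutive pairs to keep together. Hence the spanning
  subgraphs of a union of paths can be indexed by segmentations, whose components are visible.
\<close>

lemma bij_betw_links:
  assumes "distinct w" "L \<subseteq> set (zip w (tl w))"
  shows "bij_betw links {vs \<in> segmentations w. links vs \<subseteq> L} (Pow L)"
proof (rule bij_betwI[where g = "\<lambda>F. break_after (\<lambda>x. x \<notin> Domain F) w"])
  \<comment> \<open>The first letter of a consecutive pair determines the second, so \<open>Domain F\<close> determines \<open>F\<close>.\<close>
  have *: "links (break_after (\<lambda>x. x \<notin> Domain F) w) = F" if "F \<subseteq> L" for F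
    using that assms by (auto simp: links_break_after dest: zip_tl_functional)
  show "(\<lambda>F. break_after (\<lambda>x. x \<notin> Domain F) w) \<in> Pow L \<rightarrow> {vs \<in> segmentations w. links vs \<subseteq> L}"
    using * by (auto simp: segmentations_def)
  show "links (break_after (\<lambda>x. x \<notin> Domain F) w) = F" if "F \<in> Pow L" for F
    using * that by simp
  show "break_after (\<lambda>x. x \<notin> Domain (links vs)) w = vs"
    if "vs \<in> {vs \<in> segmentations w. links vs \<subseteq> L}" for vs
    using that break_after_links assms(1) by (auto simp: segmentations_def)
qed auto

lemma finite_segmentations:
  assumes "distinct w"
  shows "finite (segmentations w)"
proof -
  have "{vs \<in> segmentations w. links vs \<subseteq> set (zip w (tl w))} = segmentations w"
    using links_subset_zip by (auto simp: segmentations_def)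
  then show ?thesis
    using bij_betw_finite[OF bij_betw_links[OF assms subset_refl]] by simp
qed

lemma links_inj:
  assumes "distinct (concat us)" "[] \<notin> set us" "vs \<in> segmentations (concat us)" "links vs = links us"
  shows "vs = us"
proof -
  have vs: "concat vs = concat us" "[] \<notin> set vs"
    using assms(3) by (simp_all add: segmentations_def)
  have "vs = break_after (\<lambda>x. x \<notin> Domain (links us)) (concat us)"
    using break_after_links[of vs] assms(1,4) vs by simp
  also have "\<dots> = us"
    by (rule break_after_links[OF assms(1,2)])
  finally show ?thesis .
qed

text \<open>
  A path has one edge less than it has vertices, hence the number of segments is determined by
  the number of kept edges.
\<close>

lemma card_links:
  assumes "distinct (concat vs)" "[] \<notin> set vs"
  shows "card (links vs) + length vs = length (concat vs)" "finite (links vs)"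
proof -
  show "finite (links vs)" by (simp add: links_def)
  show "card (links vs) + length vs = length (concat vs)"
    using assms
  proof (induction vs)
    case (Cons v vs)
    have "card (set (zip v (tl v)) \<union> links vs) = card (set (zip v (tl v))) + card (links vs)"
    proof (rule card_Un_disjoint)
      have "set (zip v (tl v)) \<subseteq> set v \<times> set v" "links vs \<subseteq> set (concat vs) \<times> set (concat vs)"
        using links_subset[of "[v]"] links_subset[of vs] by simp_all
      moreover have "set v \<inter> set (concat vs) = {}" using Cons.prems(1) by simp
      ultimately show "set (zip v (tl v)) \<inter> links vs = {}"
        by blast
    qed (simp_all add: links_def)
    moreover have "card (set (zip v (tl v))) = length v - 1"
      using distinct_card[OF distinct_zipI1[of v "tl v"]] Cons.prems by simp
    moreover have "length v > 0" using Cons.prems by auto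
    ultimately show ?case using Cons.IH Cons.prems by (cases v) auto
  qed simp
qed

lemma length_refinement:
  assumes us: "distinct (concat us)" "[] \<notin> set us"
    and vs: "vs \<in> segmentations (concat us)" "links vs \<subseteq> links us" "vs \<noteq> us"
  shows "length us < length vs"
proof -
  have "links vs \<subset> links us"
    using links_inj[OF us vs(1)] vs by blast
  then have "card (links vs) < card (links us)"
    by (intro psubset_card_mono) (use card_links(2)[OF us] in auto)
  moreover have "card (links vs) + length vs = length (concat us)"
    using card_links(1)[of vs] us vs(1) by (simp add: segmentations_def)
  ultimately show ?thesis
    using card_links(1)[OF us] by linarith
qed

section \<open>Components of a disjoint union of paths\<close>

text \<open>
  A partition into connected sets that no edge leaves is the partition into components.
\<close>

lemma components_eqI:
  assumes P: "partition_on V P"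
    and inside: "\<And>a b B. (a, b) \<in> F \<Longrightarrow> B \<in> P \<Longrightarrow> a \<in> B \<longleftrightarrow> b \<in> B"
    and conn: "\<And>B a b. B \<in> P \<Longrightarrow> a \<in> B \<Longrightarrow> b \<in> B \<Longrightarrow> (a, b) \<in> (F \<union> F\<inverse>)\<^sup>*"
  shows "components V F = P"
proof -
  have stay: "b \<in> B" if "(a, b) \<in> (F \<union> F\<inverse>)\<^sup>*" "a \<in> B" "B \<in> P" for a b B
    using that by (induction rule: rtrancl_induct) (auto dest: inside)
  have cls: "(F \<union> F\<inverse>)\<^sup>* `` {a} = B" if "a \<in> B" "B \<in> P" for a B
    using stay conn that by blast
  have V: "V = \<Union>P" and ne: "{} \<notin> P"
    using P by (auto simp: partition_on_def)
  show ?thesis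
  proof
    show "components V F \<subseteq> P"
      using cls by (auto simp: components_def quotient_def V)
    show "P \<subseteq> components V F"
    proof
      fix B assume B: "B \<in> P"
      then obtain a where "a \<in> B" using ne by (metis equals0I)
      then show "B \<in> components V F"
        using cls[OF _ B] B by (auto simp: components_def quotient_def V)
    qed
  qed
qed

lemma zip_tl_connected:
  assumes "a \<in> set v" "b \<in> set v" "set (zip v (tl v)) \<subseteq> F"
  shows "(a, b) \<in> (F \<union> F\<inverse>)\<^sup>*"
  using assms
proof (induction v arbitrary: a b)
  case (Cons x v)
  show ?case
  proof (cases "v = []")
    case False
    let ?r = "(F \<union> F\<inverse>)\<^sup>*"
    have xv: "(x, hd v) \<in> F" and sub: "set (zip v (tl v)) \<subseteq> F"
      using Cons.prems(3) False by (auto simp: set_zip_tl_Cons)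
    have IH: "(c, d) \<in> ?r" if "c \<in> set v" "d \<in> set v" for c d
      using Cons.IH[OF that sub] .
    have hd: "hd v \<in> set v" using False by simp
    have 1: "(x, c) \<in> ?r" "(c, x) \<in> ?r" if "c \<in> set v" for c
    proof -
      show "(x, c) \<in> ?r" 
        using converse_rtrancl_into_rtrancl[OF _ IH[OF hd that], of x] xv by blast
      show "(c, x) \<in> ?r" 
        using rtrancl_into_rtrancl[OF IH[OF that hd], of x] xv by blast
    qed
    show ?thesis
      using Cons.prems(1,2) IH 1 by auto
  qed (use Cons.prems in auto)
qed simp

lemma partition_on_segments:
  assumes "distinct (concat vs)" "[] \<notin> set vs"
  shows "partition_on (set (concat vs)) (set ` set vs)"
proof (rule partition_onI)
  show "disjnt B C" if "B \<in> set ` set vs" "C \<in> set ` set vs" "B \<noteq> C" for B C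
    using that assms(1) by (auto simp: distinct_concat_iff disjnt_def)
qed (use assms in auto)

lemma components_links:
  assumes "distinct (concat vs)" "[] \<notin> set vs"
  shows "components (set (concat vs)) (links vs) = set ` set vs"
proof (rule components_eqI)
  show "partition_on (set (concat vs)) (set ` set vs)"
    by (rule partition_on_segments[OF assms])
next
  fix a b B assume ab: "(a, b) \<in> links vs" and "B \<in> set ` set vs"
  then obtain u v where uv: "u \<in> set vs" "v \<in> set vs" "B = set v" "(a, b) \<in> set (zip u (tl u))"
    by (auto simp: links_def)
  then have "a \<in> set u" "b \<in> set u"
    using links_subset[of "[u]"] by auto
  then show "a \<in> B \<longleftrightarrow> b \<in> B"
    using uv assms(1) by (auto simp: distinct_concat_iff)
next
  show "(a, b) \<in> (links vs \<union> (links vs)\<inverse>)\<^sup>*"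
    if "B \<in> set ` set vs" "a \<in> B" "b \<in> B" for B a b
    using that by (auto simp: links_def intro!: zip_tl_connected)
qed

lemma map_set_segments:
  assumes "distinct (concat vs)" "[] \<notin> set vs"
  shows "distinct (map set vs)"
  using assms
proof (induction vs)
  case (Cons v vs)
  have "set v \<noteq> set u" if "u \<in> set vs" for u
  proof -
    have "set v \<inter> set u = {}" "set v \<noteq> {}" using Cons.prems that by auto
    then show ?thesis by (metis Int_absorb)
  qed
  then show ?case using Cons by auto
qed simp

lemma block_sizes_segments:
  assumes "distinct (concat vs)" "[] \<notin> set vs"
  shows "block_sizes (set ` set vs) = mset (map length vs)" "card (set ` set vs) = length vs"
proof -
  have d: "distinct (map set vs)" by (rule map_set_segments[OF assms])
  have "mset_set (set ` set vs) = mset (map set vs)"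
    using mset_set_set[OF d] by simp
  then have "block_sizes (set ` set vs) = mset (map card (map set vs))"
    by (simp add: block_sizes_def multiset.map_comp)
  also have "map card (map set vs) = map length vs"
    using assms(1) by (auto simp: distinct_concat_iff distinct_card)
  finally show "block_sizes (set ` set vs) = mset (map length vs)" .
  show "card (set ` set vs) = length vs"
    using distinct_card[OF d] by simp
qed

lemma sum_Pow_links:
  assumes "distinct (concat us)" "[] \<notin> set us"
  shows "(\<Sum>F\<in>Pow (links us). h (components (set (concat us)) F)) =
    (\<Sum>vs | vs \<in> segmentations (concat us) \<and> links vs \<subseteq> links us. h (set ` set vs))"
proof -
  have "bij_betw links {vs \<in> segmentations (concat us). links vs \<subseteq> links us} (Pow (links us))"
    by (rule bij_betw_links[OF assms(1) links_subset_zip[OF assms(2)]])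
  from sum.reindex_bij_betw[OF this, of "\<lambda>F. h (components (set (concat us)) F)", symmetric]
  have "(\<Sum>F\<in>Pow (links us). h (components (set (concat us)) F)) =
    (\<Sum>vs | vs \<in> segmentations (concat us) \<and> links vs \<subseteq> links us.
      h (components (set (concat us)) (links vs)))" .
  moreover have "components (set (concat us)) (links vs) = set ` set vs"
    if "vs \<in> segmentations (concat us)" for vs
    using components_links[of vs] that assms(1) by (simp add: segmentations_def del: set_concat)
  ultimately show ?thesis by (simp del: set_concat)
qed

text \<open>
  Invariance under graph isomorphism: \<open>f\<close> is injective on the vertices because the images of the
  letters are distinct.
\<close>

lemma block_sizes_components_map:
  assumes d: "distinct (map f (concat us))" and ne: "[] \<notin> set us" and F: "F \<subseteq> links us"
  shows "block_sizes (components (f ` set (concat us)) (map_prod f f ` F)) =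
      block_sizes (components (set (concat us)) F)"
    "card (components (f ` set (concat us)) (map_prod f f ` F)) = card (components (set (concat us)) F)"
proof -
  have dus: "distinct (concat us)" using d by (simp only: distinct_map)
  have "F \<in> links ` {vs \<in> segmentations (concat us). links vs \<subseteq> links us}"
    using bij_betw_imp_surj_on[OF bij_betw_links[OF dus links_subset_zip[OF ne]]] F by simp
  then obtain vs where vs: "vs \<in> segmentations (concat us)" "F = links vs"
    by blast
  let ?vs = "map (map f) vs"
  have 1: "distinct (concat vs)" "[] \<notin> set vs" "concat vs = concat us"
    using vs dus by (auto simp: segmentations_def)
  have 2: "distinct (concat ?vs)" "[] \<notin> set ?vs"
    using d 1 by (auto simp: map_concat[symmetric])
  have "components (f ` set (concat us)) (map_prod f f ` F) = set ` set ?vs"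
    using components_links[OF 2] by (simp add: vs(2) links_map 1(3)[symmetric] map_concat[symmetric] del: set_concat)
  moreover have "components (set (concat us)) F = set ` set vs"
    using components_links[OF 1(1,2)] vs(2) 1(3) by simp
  ultimately show "block_sizes (components (f ` set (concat us)) (map_prod f f ` F)) =
      block_sizes (components (set (concat us)) F)"
    "card (components (f ` set (concat us)) (map_prod f f ` F)) = card (components (set (concat us)) F)"
    using block_sizes_segments[OF 1(1,2)] block_sizes_segments[OF 2]
    by (simp_all add: comp_def)
qed

section \<open>The path functions as sums over segmentations\<close>

text \<open>
  The paths of the union used in the definition of \<open>Xi_sf\<close>, written as words in its vertices.
\<close>

definition path_words :: "nat multiset \<Rightarrow> (nat \<times> nat) list list" where
  "path_words \<mu> = map (\<lambda>i. map (Pair i) [0..<parts_list \<mu> ! i]) [0..<length (parts_list \<mu>)]"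

lemma map_length_path_words: "map length (path_words \<mu>) = parts_list \<mu>"
  by (simp add: path_words_def comp_def map_nth)

lemma set_concat_path_words: "set (concat (path_words \<mu>)) = path_verts \<mu>"
  by (auto simp: path_words_def path_verts_def)

lemma set_zip_upt_Suc: "set (zip [a..<b] [Suc a..<b]) = {(j, Suc j) | j. a \<le> j \<and> Suc j < b}"
proof -
  have "zip [a..<b] [Suc a..<b] = map (\<lambda>j. (j, Suc j)) [a..<b - 1]"
    by (rule nth_equalityI) auto
  then show ?thesis by auto
qed

lemma links_path_words: "links (path_words \<mu>) = path_edges \<mu>"
  by (auto simp: path_words_def path_edges_def links_def zip_map_map map_tl[symmetric] set_zip_upt_Suc image_iff Bex_def)

definition path_term :: "(nat \<Rightarrow>\<^sub>0 nat) \<Rightarrow> 'a set set \<Rightarrow> rat" where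
  "path_term a P = aug_monomial_sf (block_sizes P) a / fact (card P)"

text \<open>
  Any words with the right multiset of lengths may serve as the paths in the definition of
  \<open>Xi_sf\<close>: the order of the paths does not affect the graph, and after listing them in the standard
  order a letter-by-letter renaming is a graph isomorphism.
\<close>

lemma Xi_sf_words:
  assumes d: "distinct (concat us)" and ne: "[] \<notin> set us"
  shows "Xi_sf (mset (map length us)) a =
    (\<Sum>vs | vs \<in> segmentations (concat us) \<and> links vs \<subseteq> links us. path_term a (set ` set vs))"
proof -
  define \<mu> where "\<mu> = mset (map length us)"
  define ps where "ps = path_words \<mu>"
  have "mset (parts_list \<mu>) = mset (map length us)"
    by (simp add: parts_list_def \<mu>_def)
  \<comment> \<open>The same words, listed by decreasing length as the standard paths are.\<close>
  then obtain us' where us': "mset us' = mset us" "map length us' = parts_list \<mu>"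
    using list_all2_reorder_left_invariance[of "\<lambda>m u. m = length u" "map length us" us]
    by (force simp: list_all2_map1 list_all2_refl list_all2_conv_all_nth intro!: nth_equalityI)
  have lens: "map length ps = map length us'"
    by (simp add: ps_def map_length_path_words us'(2))
  have set_us': "set us' = set us" using us'(1) by (metis set_mset_mset)
  have nep: "[] \<notin> set ps"
    using ne lens set_us' by (metis (no_types) image_iff length_0_conv list.set_map)
  define f where "f = (\<lambda>(i, j). us' ! i ! j)"
  have f: "map (map f) ps = us'"
  proof (rule nth_equalityI)
    show len: "length (map (map f) ps) = length us'"
      using lens by (metis length_map)
    fix i assume i: "i < length (map (map f) ps)"
    have "parts_list \<mu> ! i = length (us' ! i)"
      using us'(2) i len by (metis nth_map)
    then show "map (map f) ps ! i = us' ! i"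
      using i by (auto simp: ps_def path_words_def f_def intro!: nth_equalityI)
  qed
  have "mset (concat us') = mset (concat us)"
    using us'(1) by (metis mset_concat mset_map sum_mset_sum_list)
  then have df: "distinct (map f (concat ps))"
    using d f by (metis map_concat mset_eq_imp_distinct_iff)
  \<comment> \<open>Edges and vertices depend only on the set of words, so the reordering is invisible from here on.\<close>
  have links: "links us = map_prod f f ` links ps"
    using set_us' by (simp add: links_map[symmetric] f) (simp add: links_def)
  have V: "set (concat us) = f ` set (concat ps)"
    using set_us' by (metis f map_concat set_map set_concat)
  have inj: "inj_on f (set (concat ps))" using df by (simp add: distinct_map)
  have injF: "inj_on ((`) (map_prod f f)) (Pow (links ps))"
    by (intro inj_on_image_Pow inj_on_subset[OF map_prod_inj_on[OF inj inj]] links_subset)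
  have "(\<Sum>F\<in>Pow (links us). path_term a (components (set (concat us)) F)) =
      (\<Sum>F\<in>Pow (links ps). path_term a (components (set (concat us)) (map_prod f f ` F)))"
    by (simp add: links image_Pow_surj[symmetric] sum.reindex[OF injF])
  also have "\<dots> = (\<Sum>F\<in>Pow (links ps). path_term a (components (set (concat ps)) F))"
    unfolding V path_term_def
    by (intro sum.cong refl) (simp add: block_sizes_components_map[OF df nep] del: set_concat)
  also have "\<dots> = Xi_sf \<mu> a"
    unfolding Xi_sf_def path_term_def ps_def set_concat_path_words links_path_words ..
  finally show ?thesis
    using sum_Pow_links[OF d ne, of "path_term a"] by (simp add: \<mu>_def)
qed

section \<open>Linear independence of the path functions\<close>

lemma ex_words_of_lengths:
  assumes "integer_partition \<mu>"
  shows "\<exists>us :: nat list list. distinct (concat us) \<and> [] \<notin> set us \<and> mset (map length us) = \<mu>"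
  using assms
proof (induction \<mu>)
  case (add k \<mu>)
  then obtain us :: "nat list list"
    where us: "distinct (concat us)" "[] \<notin> set us" "mset (map length us) = \<mu>"
    by (auto simp: integer_partition_def)
  \<comment> \<open>Fresh letters for the new word: all old letters lie below \<open>m\<close>.\<close>
  obtain m where m: "\<forall>x\<in>set (concat us). x < m"
    using finite_nat_set_iff_bounded[of "set (concat us)"] by auto
  have "distinct (concat ([m..<m + k] # us))"
    using us(1) m by fastforce
  moreover have "[m..<m + k] \<noteq> []" using add.prems by (auto simp: integer_partition_def)
  then have "[] \<notin> set ([m..<m + k] # us)" using us(2) by (metis set_ConsD)
  moreover have "mset (map length ([m..<m + k] # us)) = add_mset k \<mu>" using us(3) by simp
  ultimately show ?case by blast
qed simp

lemma ex_exponents: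
  assumes "integer_partition \<mu>"
  shows "\<exists>a. exponents a = \<mu>"
proof -
  define xs where "xs = sorted_list_of_multiset \<mu>"
  have nz: "0 \<notin> set xs" using assms by (simp add: xs_def integer_partition_def)
  have lookup: "Poly_Mapping.lookup (Poly_Mapping.nth xs) i = nth_default 0 xs i" for i
    by simp
  have keys: "Poly_Mapping.keys (Poly_Mapping.nth xs) = {0..<length xs}"
    proof -
    have "xs ! i \<noteq> 0" if "i < length xs" for i using nz that by (metis nth_mem)
    then show ?thesis by (auto simp: in_keys_iff lookup nth_default_def simp del: keys_nth split: if_splits)
  qed
  have "exponents (Poly_Mapping.nth xs) = image_mset (nth_default 0 xs) (mset_set {0..<length xs})"
    by (simp add: exponents_def keys lookup del: keys_nth)
  also have "mset_set {0..<length xs} = mset [0..<length xs]"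
    by simp
  also have "image_mset (nth_default 0 xs) (mset [0..<length xs]) = mset (map (nth_default 0 xs) [0..<length xs])"
    by (simp only: mset_map)
  also have "map (nth_default 0 xs) [0..<length xs] = xs"
    by (rule nth_equalityI) (auto simp: nth_default_def)
  also have "mset xs = \<mu>" by (simp add: xs_def)
  finally show ?thesis by blast
qed

lemma aug_monomial_sf_eq:
  "aug_monomial_sf \<mu> a =
    (if exponents a = \<mu> then \<Prod>i\<in>set_mset \<mu>. fact (count \<mu> i) else 0)"
  by (simp add: aug_monomial_sf_def monomial_sf_def)

text \<open>
  Triangularity. A proper segmentation of the paths has more parts than \<open>\<nu>\<close>, hence more
  than the monomial has variables, so only the term keeping all edges can contribute.
\<close>

lemma Xi_sf_coeff:
  assumes \<nu>: "integer_partition \<nu>" and le: "size (exponents a) \<le> size \<nu>"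
  shows "Xi_sf \<nu> a =
    (if exponents a = \<nu> then (\<Prod>i\<in>set_mset \<nu>. fact (count \<nu> i)) / fact (size \<nu>) else 0)"
proof -
  obtain us :: "nat list list"
    where us: "distinct (concat us)" "[] \<notin> set us" "mset (map length us) = \<nu>"
    using ex_words_of_lengths[OF \<nu>] by blast
  define R where "R = {vs. vs \<in> segmentations (concat us) \<and> links vs \<subseteq> links us}"
  have fin: "finite R"
    using finite_segmentations[OF us(1)] by (simp add: R_def)
  have usR: "us \<in> R" using us by (simp add: R_def segmentations_def)
  have size: "size \<nu> = length us" using us(3) by (metis length_map size_mset)
  have zero: "path_term a (set ` set vs) = 0" if "vs \<in> R - {us}" for vs
  proof -
    have d: "distinct (concat vs)" "[] \<notin> set vs"
      using that us by (auto simp: R_def segmentations_def)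
    have "length us < length vs"
      using length_refinement[OF us(1,2)] that by (auto simp: R_def)
    then have "size (exponents a) < size (mset (map length vs))"
      using le size by simp
    then have "exponents a \<noteq> mset (map length vs)"
      by (metis less_irrefl)
    then show ?thesis
      by (simp add: path_term_def block_sizes_segments[OF d] aug_monomial_sf_eq)
  qed
  have "Xi_sf \<nu> a = (\<Sum>vs\<in>R. path_term a (set ` set vs))"
    using Xi_sf_words[OF us(1,2), of a] us(3) by (simp add: R_def)
  also have "\<dots> = path_term a (set ` set us) + (\<Sum>vs\<in>R - {us}. path_term a (set ` set vs))"
    by (rule sum.remove[OF fin usR])
  also have "\<dots> = path_term a (set ` set us)"
    using zero by simp
  finally show ?thesis
    by (simp add: path_term_def block_sizes_segments[OF us(1,2)] us(3)[unfolded mset_map] aug_monomial_sf_eq size)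
qed

lemma Xi_sf_independent:
  assumes fin: "finite S" and S: "\<And>\<mu>. \<mu> \<in> S \<Longrightarrow> integer_partition \<mu>"
    and zero: "\<And>a. (\<Sum>\<mu>\<in>S. D \<mu> * Xi_sf \<mu> a) = 0"
    and "\<mu> \<in> S"
  shows "D \<mu> = 0"
proof (rule ccontr)
  assume "D \<mu> \<noteq> 0"
  then obtain \<nu> where \<nu>: "\<nu> \<in> S" "D \<nu> \<noteq> 0"
    and min: "\<And>\<kappa>. \<kappa> \<in> S \<Longrightarrow> D \<kappa> \<noteq> 0 \<Longrightarrow> size \<nu> \<le> size \<kappa>"
    using ex_has_least_nat[of "\<lambda>\<nu>. \<nu> \<in> S \<and> D \<nu> \<noteq> 0" \<mu> size] \<open>\<mu> \<in> S\<close> by blast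
  obtain a where a: "exponents a = \<nu>"
    using ex_exponents[OF S[OF \<nu>(1)]] by blast
  let ?c = "(\<Prod>i\<in>set_mset \<nu>. fact (count \<nu> i)) / fact (size \<nu>) :: rat"
  have "D \<kappa> * Xi_sf \<kappa> a = (if \<kappa> = \<nu> then D \<nu> * ?c else 0)" if "\<kappa> \<in> S" for \<kappa>
    using Xi_sf_coeff[OF S[OF that], of a] min[OF that] a by (cases "D \<kappa> = 0") auto
  then have "(\<Sum>\<kappa>\<in>S. D \<kappa> * Xi_sf \<kappa> a) = D \<nu> * ?c"
    using \<nu>(1) fin by simp
  moreover have "?c \<noteq> 0" by simp
  ultimately show False using zero[of a] \<nu>(2) by simp
qed

section \<open>Precedence between blocks and heights\<close>

fun precedes :: "'a set list \<Rightarrow> ('a \<times> 'a) set" where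
  "precedes [] = {}"
| "precedes (B # Bs) = B \<times> \<Union>(set Bs) \<union> precedes Bs"

text \<open>
  A word as a list of singleton blocks: with it, permutations and ordered set partitions
  share the same notions of precedence and rank.
\<close>

abbreviation letters :: "'a list \<Rightarrow> 'a set list" where
  "letters w \<equiv> map (\<lambda>x. {x}) w"

text \<open>
  The orientation of the graph from earlier to later blocks; edges inside a block are dropped.
\<close>

definition arcs :: "'a set set \<Rightarrow> 'a set list \<Rightarrow> ('a \<times> 'a) set" where
  "arcs E Bs = {(u, v) \<in> precedes Bs. {u, v} \<in> E}"

definition stable :: "'a set set \<Rightarrow> 'a set \<Rightarrow> bool" where
  "stable E B \<longleftrightarrow> (\<forall>u\<in>B. \<forall>v\<in>B. {u, v} \<notin> E)"

lemma precedes_append: "precedes (As @ Bs) = precedes As \<union> precedes Bs \<union> \<Union>(set As) \<times> \<Union>(set Bs)"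
  by (induction As) auto

lemma Union_letters [simp]: "\<Union>(set (letters w)) = set w"
  by auto

lemma precedes_letters_iff_sorted_wrt: "precedes (letters w) \<subseteq> {(x, y). P x y} \<longleftrightarrow> sorted_wrt P w"
  by (induction w) auto

lemma precedes_letters_subset: "precedes (letters w) \<subseteq> set w \<times> set w"
  by (induction w) auto

lemma precedes_letters_total:
  "x \<in> set w \<Longrightarrow> y \<in> set w \<Longrightarrow> x = y \<or> (x, y) \<in> precedes (letters w) \<or> (y, x) \<in> precedes (letters w)"
  by (induction w) auto

lemma precedes_letters_concat:
  "precedes (letters (concat vs)) = (\<Union>v\<in>set vs. precedes (letters v)) \<union> precedes (map set vs)"
  by (induction vs) (auto simp: precedes_append)

text \<open>
  Refining stable blocks to single letters orients no new edge. This is why ranks do not depend on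
  the order of the letters inside the blocks.
\<close>

lemma arcs_letters_concat:
  assumes "\<And>v. v \<in> set vs \<Longrightarrow> stable E (set v)"
  shows "arcs E (letters (concat vs)) = arcs E (map set vs)"
proof -
  have "{x, y} \<notin> E" if "v \<in> set vs" "(x, y) \<in> precedes (letters v)" for v x y
    using assms[OF that(1)] that(2) precedes_letters_subset[of v] by (auto simp: stable_def)
  then show ?thesis
    unfolding arcs_def precedes_letters_concat by blast
qed

text \<open>
  The position of a letter in the word witnesses that precedence is well-founded.
\<close>

lemma ex_position:
  assumes "distinct w"
  shows "\<exists>p :: 'a \<Rightarrow> nat. precedes (letters (w :: 'a list)) \<subseteq> {(x, y). p x < p y}"
  using assms
proof (induction w)
  case (Cons x w)
  then obtain p :: "'a \<Rightarrow> nat" where p: "precedes (letters w) \<subseteq> {(x, y). p x < p y}"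
    by auto
  show ?case
    using p Cons.prems precedes_letters_subset[of w]
    by (intro exI[of _ "\<lambda>y. if y = x then 0 else Suc (p y)"]) auto
qed simp

text \<open>
  The maximal length of a directed path ending at a vertex. \<open>GREATEST\<close> is meaningful only
  when these lengths are bounded, in particular when \<open>R\<close> is increasing with respect to a function
  into the natural numbers.
\<close>

definition height :: "('a \<times> 'a) set \<Rightarrow> 'a \<Rightarrow> nat" where
  "height R v = (GREATEST r. \<exists>u. (u, v) \<in> R ^^ r)"

text \<open>
  A longest path to \<open>u\<close> can be extended by the arc from \<open>u\<close> to \<open>v\<close>. The function \<open>p\<close> bounds the
  lengths of all paths, so that longest ones exist.
\<close>

lemma height_less:
  assumes R: "R \<subseteq> {(x, y). p x < (p y :: nat)}" and uv: "(u, v) \<in> R"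
  shows "height R u < height R v"
proof -
  have "p x + r \<le> p y" if "(x, y) \<in> R ^^ r" for x y r
    using that
  proof (induction r arbitrary: y)
    case (Suc r)
    then obtain z where "(x, z) \<in> R ^^ r" "(z, y) \<in> R" by auto
    then show ?case using Suc.IH[of z] R by fastforce
  qed simp
  then have bound: "\<forall>r. (\<exists>x. (x, y) \<in> R ^^ r) \<longrightarrow> r \<le> p y" for y
    by (meson add_leE)
  have "\<exists>x. (x, u) \<in> R ^^ 0" by simp
  then have "\<exists>x. (x, u) \<in> R ^^ height R u"
    unfolding height_def
    by (rule GreatestI_nat[where P = "\<lambda>r. \<exists>x. (x, u) \<in> R ^^ r" and b = "p u"]) (use bound in auto)
  then have "\<exists>x. (x, v) \<in> R ^^ Suc (height R u)"
    using uv by auto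
  then have "Suc (height R u) \<le> height R v"
    unfolding height_def[of R v] using bound[of v] by (intro Greatest_le_nat[where b = "p v"]) auto
  then show ?thesis by simp
qed

section \<open>Descending segmentations and ordered stable partitions\<close>

text \<open>
  Pairs are ordered lexicographically, so \<open>key\<close> compares by height and breaks ties by label, just as in
  the definition of a G-ascent.
\<close>

definition key :: "nat set set \<Rightarrow> nat set list \<Rightarrow> nat \<Rightarrow> nat \<times> nat" where
  "key E Bs x = (height (arcs E Bs) x, x)"

abbreviation descending :: "('a \<Rightarrow> 'b :: linorder) \<Rightarrow> 'a list \<Rightarrow> bool" where
  "descending k \<equiv> sorted_wrt (\<lambda>x y. k y < k x)"

lemma inj_key: "inj (key E Bs)"
  by (auto simp: inj_def key_def)

lemma descending_unique:
  assumes "inj k" "descending k v" "descending k w" "set v = set w"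
  shows "v = w"
proof -
  have "map k (rev v) = map k (rev w)"
    by (rule strict_sorted_equal) (use assms in \<open>simp_all add: sorted_wrt_map sorted_wrt_rev\<close>)
  then show ?thesis using assms(1) by (simp add: inj_map_eq_map)
qed

lemma descending_exists:
  assumes "inj k" "finite B"
  shows "\<exists>v. set v = B \<and> descending k v"
proof -
  define xs where "xs = sorted_list_of_set (k ` B)"
  have xs: "set xs = k ` B" "sorted_wrt (<) xs"
    using assms by (simp_all add: xs_def)
  have "k (inv k y) = y" if "y \<in> set xs" for y
    using that xs(1) assms(1) by auto
  then have xs': "map k (map (inv k) xs) = xs"
    by (simp add: map_idI)
  have "set (rev (map (inv k) xs)) = B"
    using xs(1) assms(1) by (simp add: image_image)
  moreover have "sorted_wrt (<) (map k (map (inv k) xs))"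
    unfolding xs' by (rule xs(2))
  then have "descending k (rev (map (inv k) xs))"
    by (simp only: sorted_wrt_map sorted_wrt_rev)
  ultimately show ?thesis by blast
qed

lemma distinct_if_descending: "descending k v \<Longrightarrow> distinct v"
  by (induction v) auto

text \<open>
  The ways of cutting \<open>w\<close> such that every ascent is among the cuts.
\<close>

definition descending_segmentations :: "nat set set \<Rightarrow> nat list \<Rightarrow> nat list list set" where
  "descending_segmentations E w =
    {vs \<in> segmentations w. \<forall>v\<in>set vs. descending (key E (letters w)) v}"

text \<open>
  If two letters of a segment were adjacent, the right one would have the larger rank, but keys
  decrease along the segment.
\<close>

lemma descending_segment_stable:
  assumes E: "\<And>e. e \<in> E \<Longrightarrow> card e = 2"
    and w: "distinct w" and vs: "vs \<in> descending_segmentations E w" "v \<in> set vs"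
  shows "stable E (set v)"
proof -
  have *: "{x, y} \<notin> E" if "(x, y) \<in> precedes (letters v)" for x y
  proof
    assume "{x, y} \<in> E"
    have "(x, y) \<in> precedes (letters w)"
      using that vs precedes_letters_concat[of vs]
      by (auto simp: descending_segmentations_def segmentations_def)
    then have xy: "(x, y) \<in> arcs E (letters w)"
      using \<open>{x, y} \<in> E\<close> by (simp add: arcs_def)
    obtain p :: "nat \<Rightarrow> nat" where "precedes (letters w) \<subseteq> {(x, y). p x < p y}"
      using ex_position[OF w] by blast
    then have "arcs E (letters w) \<subseteq> {(x, y). p x < p y}"
      by (auto simp: arcs_def)
    then have "height (arcs E (letters w)) x < height (arcs E (letters w)) y"
      using xy by (rule height_less)
    moreover have "key E (letters w) y < key E (letters w) x"
      using vs that precedes_letters_iff_sorted_wrt[of v "\<lambda>x y. key E (letters w) y < key E (letters w) x"]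
      by (auto simp: descending_segmentations_def)
    ultimately show False
      by (auto simp: key_def)
  qed
  show ?thesis
    unfolding stable_def
  proof (intro ballI)
    fix x y assume xy: "x \<in> set v" "y \<in> set v"
    have "{x} \<notin> E" using E[of "{x}"] by auto
    then show "{x, y} \<notin> E"
      using precedes_letters_total[OF xy] *[of x y] *[of y x] by (auto simp: insert_commute)
  qed
qed

lemma stable_partitions_eq:
  "stable_partitions V E = {P. partition_on V P \<and> (\<forall>B\<in>P. stable E B)}"
  by (simp add: stable_partitions_def stable_def)

text \<open>
  Forgetting the order inside the segments loses nothing: the keys can be computed from the list of
  blocks because the blocks are stable, and a set has only one descending arrangement.
  The first component of the image is the underlying unordered partition, which makes the later
  summation over the orderings of a fixed partition immediate.
\<close>

lemma bij_betw_ordered_stable_partitions: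
  assumes V: "finite V" and E: "\<And>e. e \<in> E \<Longrightarrow> card e = 2"
  shows "bij_betw (\<lambda>(w, vs). (set ` set vs, map set vs))
    (SIGMA w:permutations_of_set V. descending_segmentations E w)
    (SIGMA P:stable_partitions V E. permutations_of_set P)"
  (is "bij_betw ?f ?A ?B")
  unfolding bij_betw_def
proof (intro conjI subset_antisym)
  have A: "concat vs = w" "distinct (concat vs)" "[] \<notin> set vs" "set w = V"
      "\<And>v. v \<in> set vs \<Longrightarrow> stable E (set v)" "key E (letters w) = key E (map set vs)"
      "\<And>v. v \<in> set vs \<Longrightarrow> descending (key E (map set vs)) v"
    if "(w, vs) \<in> ?A" for w vs
  proof -
    show 1: "concat vs = w" "distinct (concat vs)" "[] \<notin> set vs" "set w = V"
      using that by (auto simp: descending_segmentations_def segmentations_def permutations_of_set_def)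
    show 2: "stable E (set v)" if "v \<in> set vs" for v
      using descending_segment_stable[OF E _ _ that] \<open>(w, vs) \<in> ?A\<close>
      by (auto simp: permutations_of_set_def)
    show 3: "key E (letters w) = key E (map set vs)"
      using arcs_letters_concat[of vs E] 2 1(1) by (simp add: key_def fun_eq_iff)
    show "descending (key E (map set vs)) v" if "v \<in> set vs" for v
      using that \<open>(w, vs) \<in> ?A\<close> unfolding 3[symmetric] by (auto simp: descending_segmentations_def)
  qed
  show "inj_on ?f ?A"
  proof (rule inj_onI, clarify)
    fix w vs w' vs'
    assume "w \<in> permutations_of_set V" "vs \<in> descending_segmentations E w"
      "w' \<in> permutations_of_set V" "vs' \<in> descending_segmentations E w'"
    then have in_A: "(w, vs) \<in> ?A" "(w', vs') \<in> ?A" by auto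
    assume eq: "map set vs = map set vs'"
    have "inj_on set (set vs \<union> set vs')"
    proof (rule inj_onI)
      fix v v' assume "v \<in> set vs \<union> set vs'" "v' \<in> set vs \<union> set vs'" "set v = set v'"
      moreover have "descending (key E (map set vs)) v" if "v \<in> set vs \<union> set vs'" for v
        using that A(7)[OF in_A(1)] A(7)[OF in_A(2)] eq by auto
      ultimately show "v = v'"
        using descending_unique[OF inj_key] by blast
    qed
    then have "vs = vs'"
      using eq by (rule map_inj_on[rotated])
    then show "w = w' \<and> vs = vs'"
      using A(1)[OF in_A(1)] A(1)[OF in_A(2)] by simp
  qed
  show "?f ` ?A \<subseteq> ?B"
  proof clarify
    fix w vs assume "w \<in> permutations_of_set V" "vs \<in> descending_segmentations E w"
    then have "(w, vs) \<in> ?A" by auto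
    note A = A[OF this]
    have "partition_on V (set ` set vs)"
      using partition_on_segments[OF A(2,3)] A(1,4) by simp
    then show "set ` set vs \<in> stable_partitions V E \<and> map set vs \<in> permutations_of_set (set ` set vs)"
      using A(5) map_set_segments[OF A(2,3)]
      by (auto simp: stable_partitions_eq permutations_of_set_def)
  qed
  show "?B \<subseteq> ?f ` ?A"
  proof clarify
    fix P Bs assume P: "P \<in> stable_partitions V E" and "Bs \<in> permutations_of_set P"
    then have Bs: "set Bs = P" "distinct Bs" by (auto simp: permutations_of_set_def)
    have part: "partition_on V P" and stab: "\<And>B. B \<in> P \<Longrightarrow> stable E B"
      using P by (auto simp: stable_partitions_eq)
    have "finite B" if "B \<in> P" for B
      using part that V by (metis partition_onD1 Union_upper rev_finite_subset)
    then have "\<exists>v. set v = B \<and> descending (key E Bs) v" if "B \<in> P" for B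
      using that descending_exists[OF inj_key] by blast
    then obtain g where g: "\<And>B. B \<in> P \<Longrightarrow> set (g B) = B \<and> descending (key E Bs) (g B)"
      by metis
    define vs where "vs = map g Bs"
    define w where "w = concat vs"
    have "map (set \<circ> g) Bs = Bs"
      by (rule map_idI) (use g Bs(1) in auto)
    then have map_vs: "map set vs = Bs"
      by (simp add: vs_def)
    have set_vs: "set ` set vs = P"
      using map_vs Bs(1) by (metis list.set_map)
    have set_w: "set w = V"
      using set_vs partition_onD1[OF part] by (simp add: w_def)
    have desc: "descending (key E Bs) v" if "v \<in> set vs" for v
      using that g Bs(1) by (auto simp: vs_def)
    have dist_w: "distinct w"
      unfolding w_def
    proof (rule distinct_concat)
      show "distinct vs"
        using map_vs Bs(2) by (metis distinct_map)
      show "distinct v" if "v \<in> set vs" for v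
        using desc[OF that] by (rule distinct_if_descending)
      show "set u \<inter> set v = {}" if uv: "u \<in> set vs" "v \<in> set vs" "u \<noteq> v" for u v
      proof -
        obtain B C where "u = g B" "v = g C" "B \<in> P" "C \<in> P"
          using uv(1,2) Bs(1) by (auto simp: vs_def)
        moreover from this have "B \<noteq> C" using uv(3) by auto
        ultimately show ?thesis
          using g partition_onD2[OF part] by (auto simp: disjoint_def)
      qed
    qed
    have "[] \<notin> set vs"
      using set_vs partition_onD3[OF part] by (metis image_eqI list.set(1))
    moreover have "key E (letters w) = key E Bs"
      using arcs_letters_concat[of vs E] stab set_vs map_vs
      by (auto simp: key_def fun_eq_iff w_def)
    ultimately have "(w, vs) \<in> ?A"
      using dist_w set_w desc
      by (auto simp: permutations_of_set_def descending_segmentations_def segmentations_def w_def)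
    then show "(P, Bs) \<in> ?f ` ?A"
      using set_vs map_vs by force
  qed
qed

section \<open>Ranks and ascents of permutations\<close>

lemma precedes_letters_map_upt:
  "precedes (letters (map \<pi> [a..<b])) = {(\<pi> i, \<pi> j) | i j. a \<le> i \<and> i < j \<and> j < b}"
proof (induction b)
  case (Suc b)
  show ?case
  proof (cases "a \<le> b")
    case True
    have "precedes (letters (map \<pi> [a..<Suc b])) =
        precedes (letters (map \<pi> [a..<b])) \<union> \<pi> ` {a..<b} \<times> {\<pi> b}"
      using True by (auto simp: precedes_append)
    then show ?thesis
      unfolding Suc.IH less_Suc_eq using True by (auto simp del: upt_Suc) blast+
  qed auto
qed simp

abbreviation word :: "nat \<Rightarrow> (nat \<Rightarrow> nat) \<Rightarrow> nat list" where
  "word n \<pi> \<equiv> map \<pi> [1..<n + 1]"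

text \<open>
  An increasing sequence of positions is traded for the sequence of letters at these positions.
\<close>

lemma rank_eq_height:
  assumes \<pi>: "\<pi> permutes {1..n}" and v: "v \<in> {1..n}"
  shows "rank E \<pi> v = height (arcs E (letters (word n \<pi>))) v"
proof -
  define R where "R = arcs E (letters (word n \<pi>))"
  have R: "R = {(\<pi> i, \<pi> j) | i j. 1 \<le> i \<and> i < j \<and> j \<le> n \<and> {\<pi> i, \<pi> j} \<in> E}"
    unfolding R_def arcs_def precedes_letters_map_upt by (simp add: less_Suc_eq_le) blast
  have inv: "inv \<pi> (\<pi> x) = x" "\<pi> (inv \<pi> x) = x" for x
    using permutes_inverses[OF \<pi>] by simp_all
  have pos: "inv \<pi> v \<in> {1..n}"
    using v permutes_in_image[OF permutes_inv[OF \<pi>]] by blast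
  have "(\<exists>i :: nat \<Rightarrow> nat.
     (\<forall>j\<in>{1..r + 1}. 0 < i j) \<and> strict_mono_on {1..r + 1} i \<and> i (r + 1) = inv \<pi> v \<and>
     (\<forall>j\<in>{1..r}. {\<pi> (i j), \<pi> (i (j + 1))} \<in> E)) \<longleftrightarrow> (\<exists>u. (u, v) \<in> R ^^ r)"
    (is "?L \<longleftrightarrow> ?R") for r
  proof
    assume ?L
    then obtain i :: "nat \<Rightarrow> nat" where i: "\<forall>j\<in>{1..r + 1}. 0 < i j" "strict_mono_on {1..r + 1} i"
      "i (r + 1) = inv \<pi> v" "\<forall>j\<in>{1..r}. {\<pi> (i j), \<pi> (i (j + 1))} \<in> E" by blast
    define f where "f = (\<lambda>j. \<pi> (i (j + 1)))"
    have "(f j, f (Suc j)) \<in> R" if "j < r" for j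
    proof -
      have "i (j + 1) < i (Suc j + 1)"
        by (rule strict_mono_onD[OF i(2)]) (use that in auto)
      moreover have "i (Suc j + 1) \<le> i (r + 1)"
        by (rule strict_mono_on_leD[OF i(2)]) (use that in auto)
      moreover have "0 < i (j + 1)" "{\<pi> (i (j + 1)), \<pi> (i (Suc j + 1))} \<in> E"
        using i(1,4) that by auto
      ultimately show ?thesis
        unfolding R f_def using pos i(3) by fastforce
    qed
    moreover have "f r = v" using i(3) inv by (simp add: f_def)
    ultimately have "(f 0, v) \<in> R ^^ r"
      unfolding relpow_fun_conv by blast
    then show ?R by blast
  next
    assume ?R
    then obtain u f where f: "f 0 = u" "f r = v" "\<And>j. j < r \<Longrightarrow> (f j, f (Suc j)) \<in> R"
      unfolding relpow_fun_conv by blast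
    \<comment> \<open>The positions are numbered from 1, whereas \<open>f\<close> starts at 0.\<close>
    define i where "i = (\<lambda>j. inv \<pi> (f (j - 1)))"
    have step: "0 < i (Suc j) \<and> i (Suc j) < i (Suc (Suc j)) \<and> {\<pi> (i (Suc j)), \<pi> (i (Suc (Suc j)))} \<in> E"
      if "j < r" for j
      using f(3)[OF that] inv by (auto simp: R i_def)
    have last: "i (Suc r) = inv \<pi> v" by (simp add: i_def f(2))
    have mono: "k \<le> r \<Longrightarrow> j < k \<Longrightarrow> i (Suc j) < i (Suc k)" for j k
    proof (induction k)
      case (Suc k)
      then show ?case using step[of k] by (auto simp: less_Suc_eq)
    qed simp
    have "strict_mono_on {1..r + 1} i"
    proof (rule strict_mono_onI)
      fix j k assume "j \<in> {1..r + 1}" "k \<in> {1..r + 1}" "j < k"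
      then show "i j < i k"
        using mono[of "k - 1" "j - 1"] by auto
    qed
    moreover have "0 < i j" if "j \<in> {1..r + 1}" for j
    proof (cases "j = r + 1")
      case True then show ?thesis using last pos by auto
    next
      case False then show ?thesis using step[of "j - 1"] that by auto
    qed
    moreover have "{\<pi> (i j), \<pi> (i (j + 1))} \<in> E" if "j \<in> {1..r}" for j
      using step[of "j - 1"] that by auto
    ultimately show ?L
      using last by (intro exI[of _ i]) auto
  qed
  then show ?thesis
    unfolding rank_def height_def R_def[symmetric] by simp
qed

lemma G_ascent_iff_key_less:
  assumes \<pi>: "\<pi> permutes {1..n}" and xy: "(x, y) \<in> set (zip (word n \<pi>) (tl (word n \<pi>)))"
  shows "G_ascent n E \<pi> x \<longleftrightarrow> key E (letters (word n \<pi>)) x < key E (letters (word n \<pi>)) y"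
proof -
  have "set (zip (word n \<pi>) (tl (word n \<pi>))) = map_prod \<pi> \<pi> ` set (zip [1..<n + 1] [Suc 1..<n + 1])"
    by (simp add: zip_map_map map_tl[symmetric] map_prod_def del: upt_Suc)
  then obtain i where i: "1 \<le> i" "i < n" "x = \<pi> i" "y = \<pi> (Suc i)"
    using xy by (auto simp: set_zip_upt_Suc simp del: upt_Suc)
  have x: "x \<in> {1..n}" and y: "y \<in> {1..n}"
    using i permutes_in_image[OF \<pi>] by auto
  have "inv \<pi> x = i" using permutes_inverses[OF \<pi>] i by simp
  then show ?thesis
    using i x rank_eq_height[OF \<pi> x, of E] rank_eq_height[OF \<pi> y, of E]
    by (auto simp: G_ascent_def key_def Let_def simp del: upt_Suc)
qed

lemma zip_tl_subset_iff_sorted_wrt: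
  assumes "transp P"
  shows "set (zip v (tl v)) \<subseteq> {(x, y). P x y} \<longleftrightarrow> sorted_wrt P v"
  using assms by (induction v rule: induct_list012) (auto simp: sorted_wrt2 sorted_wrt1 simp del: sorted_wrt.simps(2))

lemma distinct_word:
  assumes "\<pi> permutes {1..n}"
  shows "distinct (word n \<pi>)" "set (word n \<pi>) = {1..n}"
proof -
  show "distinct (word n \<pi>)"
    using permutes_inj_on[OF assms] by (simp add: distinct_map del: upt_Suc)
  have "set (word n \<pi>) = \<pi> ` {1..n}" by (auto simp del: upt_Suc)
  then show "set (word n \<pi>) = {1..n}" using permutes_image[OF assms] by simp
qed

text \<open>
  Keeping only edges that are not ascents means that adjacent letters in a segment have decreasing
  keys; by transitivity the whole segment is descending.
\<close>

lemma Xi_sf_G_ascent_type: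
  assumes \<pi>: "\<pi> permutes {1..n}"
  shows "Xi_sf (G_ascent_type n E \<pi>) a =
    (\<Sum>vs\<in>descending_segmentations E (word n \<pi>). path_term a (set ` set vs))"
proof -
  define w where "w = word n \<pi>"
  define k where "k = key E (letters w)"
  \<comment> \<open>The word itself supplies the paths, cut at the ascents.\<close>
  define us where "us = break_after (G_ascent n E \<pi>) w"
  have dw: "distinct w" using distinct_word[OF \<pi>] by (simp add: w_def)
  have "x \<noteq> y" if "(x, y) \<in> set (zip w (tl w))" for x y
    using that dw by (auto simp: set_zip nth_tl nth_eq_iff_index_eq)
  then have neq: "k x \<noteq> k y" if "(x, y) \<in> set (zip w (tl w))" for x y
    using that inj_key[of E "letters w"] unfolding k_def[symmetric] inj_def by blast
  have links_us: "links us = {(x, y) \<in> set (zip w (tl w)). k y < k x}"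
    using G_ascent_iff_key_less[OF \<pi>, of _ _ E] neq
    unfolding us_def links_break_after w_def[symmetric] k_def[symmetric]
    by (fastforce simp: not_less order.order_iff_strict)
  have "links vs \<subseteq> links us \<longleftrightarrow> (\<forall>v\<in>set vs. descending k v)" if "vs \<in> segmentations w" for vs
  proof -
    have "links vs \<subseteq> set (zip w (tl w))"
      using links_subset_zip[of vs] that by (simp add: segmentations_def)
    then have "links vs \<subseteq> links us \<longleftrightarrow> links vs \<subseteq> {(x, y). k y < k x}"
      unfolding links_us by blast
    also have "\<dots> \<longleftrightarrow> (\<forall>v\<in>set vs. set (zip v (tl v)) \<subseteq> {(x, y). k y < k x})"
      unfolding links_def by blast
    also have "\<dots> \<longleftrightarrow> (\<forall>v\<in>set vs. descending k v)"
      by (subst zip_tl_subset_iff_sorted_wrt) (auto simp: transp_def)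
    finally show ?thesis .
  qed
  then have "{vs. vs \<in> segmentations w \<and> links vs \<subseteq> links us} = descending_segmentations E w"
    by (auto simp: descending_segmentations_def k_def)
  then show ?thesis
    using Xi_sf_words[of us a] dw
    by (simp add: us_def G_ascent_type_def w_def del: upt_Suc)
qed

lemma bij_betw_word:
  "bij_betw (word n) {\<pi>. \<pi> permutes {1..n}} (permutations_of_set {1..n})"
proof -
  have inj: "inj_on (word n) {\<pi>. \<pi> permutes {1..n}}"
  proof (rule inj_onI)
    fix \<pi> \<sigma> assume "\<pi> \<in> {\<pi>. \<pi> permutes {1..n}}" "\<sigma> \<in> {\<pi>. \<pi> permutes {1..n}}"
      and eq: "word n \<pi> = word n \<sigma>"
    moreover have "\<pi> x = \<sigma> x" if "x \<in> {1..n}" for x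
      using eq that by (auto simp: map_eq_conv simp del: upt_Suc)
    ultimately show "\<pi> = \<sigma>"
      by (auto simp: permutes_def fun_eq_iff) metis
  qed
  \<comment> \<open>Surjectivity by counting: both sides have \<open>n!\<close> elements.\<close>
  moreover have "word n ` {\<pi>. \<pi> permutes {1..n}} = permutations_of_set {1..n}"
  proof (rule card_subset_eq)
    show "word n ` {\<pi>. \<pi> permutes {1..n}} \<subseteq> permutations_of_set {1..n}"
      using distinct_word by (auto simp: permutations_of_set_def simp del: upt_Suc)
    show "card (word n ` {\<pi>. \<pi> permutes {1..n}}) = card (permutations_of_set {1..n})"
      using card_image[OF inj] card_permutations[of "{1..n}" n] by (simp del: upt_Suc)
  qed simp
  ultimately show ?thesis by (simp add: bij_betw_def)
qed

section \<open>The expansion of the chromatic symmetric function\<close>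

text \<open>
  The weight of a segmentation depends only on its set of blocks, so the sum over permutations
  becomes a sum over orderings of stable partitions, each stable partition \<open>P\<close> being counted
  \<open>fact (card P)\<close> times.
\<close>

lemma chromatic_sf_eq_sum_Xi_sf:
  assumes "simple_graph {1..n} E"
  shows "chromatic_sf {1..n} E a = (\<Sum>\<pi> | \<pi> permutes {1..n}. Xi_sf (G_ascent_type n E \<pi>) a)"
proof -
  define V where "V = {1..n}"
  have E: "card e = 2" if "e \<in> E" for e using assms that by (simp add: simple_graph_def)
  have fin: "finite (descending_segmentations E w)" if "w \<in> permutations_of_set V" for w
    using finite_segmentations[of w] that
    by (auto simp: permutations_of_set_def descending_segmentations_def)
  have "finite (stable_partitions V E)"
    by (rule finite_subset[OF _ finitely_many_partition_on[of V]])
      (auto simp: stable_partitions_def V_def)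
  have finP: "finite P" if "P \<in> stable_partitions V E" for P
    using that finite_elements[of V P] by (auto simp: stable_partitions_def V_def)
  have "(\<Sum>\<pi> | \<pi> permutes {1..n}. Xi_sf (G_ascent_type n E \<pi>) a) =
      (\<Sum>\<pi> | \<pi> permutes {1..n}. \<Sum>vs\<in>descending_segmentations E (word n \<pi>). path_term a (set ` set vs))"
    by (intro sum.cong) (auto simp: Xi_sf_G_ascent_type simp del: upt_Suc)
  also have "\<dots> = (\<Sum>w\<in>permutations_of_set V. \<Sum>vs\<in>descending_segmentations E w. path_term a (set ` set vs))"
    unfolding V_def by (rule sum.reindex_bij_betw[OF bij_betw_word])
  also have "\<dots> = (\<Sum>(w, vs)\<in>(SIGMA w:permutations_of_set V. descending_segmentations E w). path_term a (set ` set vs))"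
    by (rule sum.Sigma) (use fin in auto)
  also have "\<dots> = (\<Sum>(P, Bs)\<in>(SIGMA P:stable_partitions V E. permutations_of_set P). path_term a P)"
    using sum.reindex_bij_betw[OF bij_betw_ordered_stable_partitions[of V E], of "\<lambda>(P, Bs). path_term a P"] E
    by (simp add: V_def case_prod_unfold)
  also have "\<dots> = (\<Sum>P\<in>stable_partitions V E. \<Sum>Bs\<in>permutations_of_set P. path_term a P)"
    by (rule sum.Sigma[symmetric]) (use \<open>finite (stable_partitions V E)\<close> finP in auto)
  also have "\<dots> = (\<Sum>P\<in>stable_partitions V E. aug_monomial_sf (block_sizes P) a)"
    by (intro sum.cong refl) (simp add: path_term_def finP)
  finally show ?thesis
    unfolding chromatic_sf_def V_def by (rule sym)
qed

lemma integer_partition_G_ascent_type: "integer_partition (G_ascent_type n E \<pi>)"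
  by (auto simp: integer_partition_def G_ascent_type_def simp del: upt_Suc)

theorem theorem6:
  fixes n :: nat and E :: "nat set set" and N :: "nat multiset \<Rightarrow> rat"
  assumes graph: "simple_graph {1..n} E"
    and finite_support: "finite {\<mu>. integer_partition \<mu> \<and> N \<mu> \<noteq> 0}"
    and expansion: "chromatic_sf {1..n} E =
      (\<lambda>a. \<Sum>\<mu> | integer_partition \<mu> \<and> N \<mu> \<noteq> 0. N \<mu> * Xi_sf \<mu> a)"
  shows "\<forall>\<mu>. integer_partition \<mu> \<longrightarrow>
    N \<mu> = of_nat (card {\<pi>. \<pi> permutes {1..n} \<and> G_ascent_type n E \<pi> = \<mu>})"
proof (intro allI impI)
  fix \<mu> assume \<mu>: "integer_partition \<mu>"
  define perms where "perms = {\<pi>. \<pi> permutes {1..n}}"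
  define T where "T = G_ascent_type n E"
  define c :: "nat multiset \<Rightarrow> rat" where "c = (\<lambda>\<mu>. of_nat (card {\<pi> \<in> perms. T \<pi> = \<mu>}))"
  \<comment> \<open>A finite set of partitions outside of which both coefficient families vanish.\<close>
  define S where "S = insert \<mu> ({\<mu>. integer_partition \<mu> \<and> N \<mu> \<noteq> 0} \<union> T ` perms)"
  have fin_perms: "finite perms" by (simp add: perms_def finite_permutations)
  have fin: "finite S"
    using finite_support fin_perms by (simp add: S_def)
  have S: "integer_partition \<nu>" if "\<nu> \<in> S" for \<nu>
    using that \<mu> integer_partition_G_ascent_type by (auto simp: S_def T_def)
  have "(\<Sum>\<nu>\<in>S. (N \<nu> - c \<nu>) * Xi_sf \<nu> a) = 0" for a
  proof -
    have "(\<Sum>\<nu>\<in>S. c \<nu> * Xi_sf \<nu> a) = (\<Sum>\<nu>\<in>S. \<Sum>\<pi> | \<pi> \<in> perms \<and> T \<pi> = \<nu>. Xi_sf (T \<pi>) a)"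
      by (intro sum.cong refl) (simp add: c_def)
    also have "\<dots> = (\<Sum>\<pi>\<in>perms. Xi_sf (T \<pi>) a)"
      by (rule sum.group[OF fin_perms fin]) (auto simp: S_def)
    also have "\<dots> = chromatic_sf {1..n} E a"
      unfolding chromatic_sf_eq_sum_Xi_sf[OF graph] perms_def T_def ..
    also have "\<dots> = (\<Sum>\<nu>\<in>S. N \<nu> * Xi_sf \<nu> a)"
      unfolding expansion by (rule sum.mono_neutral_left[OF fin]) (use S in \<open>auto simp: S_def\<close>)
    finally show ?thesis by (simp add: left_diff_distrib sum_subtractf)
  qed
  then have "N \<mu> - c \<mu> = 0"
    by (rule Xi_sf_independent[OF fin S, rotated]) (simp_all add: S_def)
  then show "N \<mu> = of_nat (card {\<pi>. \<pi> permutes {1..n} \<and> G_ascent_type n E \<pi> = \<mu>})"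
    by (simp add: c_def perms_def T_def)
qed

end
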